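(* Let $M$ be an $n$-dimensional submanifold of the Euclidean space $\mathbb R^{n+p}$, with induced metric $g$, and let $k\ge0$ be an integer with $2k<n$. Then $M$ is $(2k)$-minimal if and only if the coordinate functions of $\mathbb R^{n+p}$ restricted to $M$ are $\ell_{2k}$-harmonic functions on $M$.
   Context: Double forms. On an $n$-dimensional Euclidean vector space $(V,g)$, a $(p,q)$-double form is an element of $\Lambda^pV^*\otimes\Lambda^qV^*$, viewed as a bilinear form $\Lambda^pV\times\Lambda^qV\to\mathbb R$. The exterior product is $(\theta_1\otimes\theta_2)(\theta_3\otimes\theta_4)=(\theta_1\wedge\theta_3)\otimes(\theta_2\wedge\theta_4)$, so that $B^k(x_1\wedge\dots\wedge x_k,y_1\wedge\dots\wedge y_k)=k!\det[B(x_i,y_j)]$ for a symmetric bilinear form $B$. The generalized Hodge star on $(p,q)$-double forms is $*\omega(\cdot,\cdot)=(-1)^{(p+q)(n-p-q)}\omega( *\cdot,*\cdot)$, with the usual Hodge star on the right; for an $(n,n)$-double form, $*\omega=\omega(e_1\wedge\dots\wedge e_n,e_1\wedge\dots\wedge e_n)$ with $(e_i)$ orthonormal. For $(1,1)$-double forms, $\langle S,T\rangle=\sum_{i,j}S(e_i,e_j)T(e_i,e_j)$. These operations are applied pointwise on tangent spaces. The Riemann tensor $R$ of $(M,g)$ is viewed as a symmetric $(2,2)$-double form, with sign such that $R(x\wedge y,x\wedge y)$ is the sectional curvature for orthonormal $x,y$. The $(2k)$-th Einstein-Lovelock tensor is $T_{2k}=*\frac{1}{(n-2k-1)!}g^{n-2k-1}R^k$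 for $2k<n$ (so $T_0=g$). For a smooth function $f$, $\ell_{2k}(f)=-\langle T_{2k},\mathrm{Hess}(f)\rangle$; $f$ is $\ell_{2k}$-harmonic if $\ell_{2k}(f)=0$. For a submanifold with vector-valued second fundamental form $B$ and a normal vector $N$, $B_N(u,v)=\langle B(u,v),N\rangle$ and $h_{2k+1}(N)=*\left(\frac{g^{n-2k-1}}{(n-2k-1)!}R^kB_N\right)$. $M$ is $(2k)$-minimal if $h_{2k+1}(N)=0$ for all normal vectors $N$ at all points of $M$. For $v\in\mathbb R^{n+p}$ the coordinate function $f_v:M\to\mathbb R$ is $f_v(m)=\langle v,m\rangle$. *)

theory Defs
  imports "HOL-Analysis.Analysis" "HOL-Combinatorics.Permutations"
begin

section \<open>Double forms on a Euclidean vector space\<close>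

text \<open>
  An element \<open>\<omega>\<close> of the algebra of double forms (the direct sum of all
  \<open>\<Lambda>\<^sup>p V\<^sup>* \<otimes> \<Lambda>\<^sup>q V\<^sup>*\<close>) is represented by its values on pairs of decomposable
  multivectors: \<open>\<omega> [x\<^sub>1,\<dots>,x\<^sub>p] [y\<^sub>1,\<dots>,y\<^sub>q]\<close> stands for
  \<open>\<omega>(x\<^sub>1 \<and> \<dots> \<and> x\<^sub>p, y\<^sub>1 \<and> \<dots> \<and> y\<^sub>q)\<close>. A form of pure bidegree \<open>(p,q)\<close> vanishes on
  lists of any other lengths, so the bidegree need not be carried along.
\<close>

type_synonym 'v dform = "'v list \<Rightarrow> 'v list \<Rightarrow> real"

definition df_one :: "'v dform" where
  "df_one xs ys = (if xs = [] \<and> ys = [] then 1 else 0)"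

definition df_scale :: "real \<Rightarrow> 'v dform \<Rightarrow> 'v dform" where
  "df_scale c \<omega> xs ys = c * \<omega> xs ys"

definition df_bilinear :: "('v \<Rightarrow> 'v \<Rightarrow> real) \<Rightarrow> 'v dform" where
  "df_bilinear B xs ys =
     (if length xs = 1 \<and> length ys = 1 then B (xs ! 0) (ys ! 0) else 0)"

text \<open>
  Sign of the shuffle which lists first the positions in \<open>I\<close> and then the remaining
  ones, each in increasing order.
\<close>

definition shuffle_sign :: "nat set \<Rightarrow> real" where
  "shuffle_sign I = (-1) ^ card {(i, j). i \<in> I \<and> j \<notin> I \<and> j < i}"

text \<open>
  The exterior product is the wedge product in each of the two factors, with the
  normalisation \<open>(\<alpha> \<and> \<beta>)(x\<^sub>1,\<dots>,x\<^sub>m) = \<Sum>\<^sub>I sgn(I) \<alpha>(x\<^sub>I) \<beta>(x\<^sub>I\<^sub>c)\<close> (sum over shuffles), for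
  which \<open>B\<^sup>k(x\<^sub>1 \<and> \<dots> \<and> x\<^sub>k, y\<^sub>1 \<and> \<dots> \<and> y\<^sub>k) = k! det [B(x\<^sub>i, y\<^sub>j)]\<close>.
\<close>

definition df_prod :: "'v dform \<Rightarrow> 'v dform \<Rightarrow> 'v dform" where
  "df_prod \<omega> \<eta> xs ys =
     (\<Sum>I \<in> Pow {..<length xs}. \<Sum>J \<in> Pow {..<length ys}.
        shuffle_sign I * shuffle_sign J *
        \<omega> (nths xs I) (nths ys J) * \<eta> (nths xs (- I)) (nths ys (- J)))"

primrec df_power :: "'v dform \<Rightarrow> nat \<Rightarrow> 'v dform" where
  "df_power \<omega> 0 = df_one"
| "df_power \<omega> (Suc k) = df_prod \<omega> (df_power \<omega> k)"

text \<open>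
  The Euclidean structure \<open>g\<close> is an explicit argument; it is not the inner product of
  the type \<open>'v\<close>, which only supplies the dimension. The operations below use some
  \<open>g\<close>-orthonormal basis; they do not depend on which one, nor on its orientation.
\<close>

definition orthonormal_basis :: "('v::euclidean_space \<Rightarrow> 'v \<Rightarrow> real) \<Rightarrow> 'v list \<Rightarrow> bool" where
  "orthonormal_basis g e \<longleftrightarrow> length e = DIM('v) \<and>
     (\<forall>i < DIM('v). \<forall>j < DIM('v). g (e ! i) (e ! j) = (if i = j then 1 else 0))"

definition frame :: "('v::euclidean_space \<Rightarrow> 'v \<Rightarrow> real) \<Rightarrow> 'v list" where
  "frame g = (SOME e. orthonormal_basis g e)"

text \<open>The number \<open>c\<close> with \<open>x\<^sub>1 \<and> \<dots> \<and> x\<^sub>n = c e\<^sub>1 \<and> \<dots> \<and> e\<^sub>n\<close>.\<close>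

definition volume_coeff :: "('v \<Rightarrow> 'v \<Rightarrow> real) \<Rightarrow> 'v list \<Rightarrow> 'v list \<Rightarrow> real" where
  "volume_coeff g e xs =
     (\<Sum>\<sigma> | \<sigma> permutes {..<length e}.
        of_int (sign \<sigma>) * (\<Prod>i<length e. g (xs ! i) (e ! \<sigma> i)))"

text \<open>
  With \<open>e\<^sub>J\<close> the wedge of the \<open>e\<^sub>j\<close>, \<open>j \<in> J\<close> increasing, the usual Hodge star satisfies
  \<open>\<langle>*X, e\<^sub>J\<rangle> e\<^sub>1 \<and> \<dots> \<and> e\<^sub>n = X \<and> e\<^sub>J\<close>, hence
  \<open>*(x\<^sub>1 \<and> \<dots> \<and> x\<^sub>r) = \<Sum>\<^sub>J hodge_coeff g e xs J \<cdot> e\<^sub>J\<close>, the sum being over \<open>|J| = n - r\<close>.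
\<close>

definition hodge_coeff :: "('v \<Rightarrow> 'v \<Rightarrow> real) \<Rightarrow> 'v list \<Rightarrow> 'v list \<Rightarrow> nat set \<Rightarrow> real" where
  "hodge_coeff g e xs J = volume_coeff g e (xs @ nths e J)"

text \<open>
  \<open>*\<omega>(X, Y) = (-1)^((p+q)(n-p-q)) \<omega>(*X, *Y)\<close>, expanded bilinearly. On multivectors
  \<open>X\<close>, \<open>Y\<close> of degrees \<open>r\<close>, \<open>s\<close> only the component of \<open>\<omega>\<close> of bidegree
  \<open>(p,q) = (n-r, n-s)\<close> contributes. Scalars are the values at \<open>([], [])\<close>.
\<close>

definition df_hodge :: "('v::euclidean_space \<Rightarrow> 'v \<Rightarrow> real) \<Rightarrow> 'v dform \<Rightarrow> 'v dform" where
  "df_hodge g \<omega> xs ys =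
     (let e = frame g; n = DIM('v); p = n - length xs; q = n - length ys in
       (-1) powi (int (p + q) * (int n - int p - int q)) *
       (\<Sum>J | J \<subseteq> {..<n} \<and> length xs + card J = n.
        \<Sum>K | K \<subseteq> {..<n} \<and> length ys + card K = n.
          hodge_coeff g e xs J * hodge_coeff g e ys K * \<omega> (nths e J) (nths e K)))"

definition df_inner11 :: "('v::euclidean_space \<Rightarrow> 'v \<Rightarrow> real) \<Rightarrow> 'v dform \<Rightarrow> 'v dform \<Rightarrow> real" where
  "df_inner11 g S T =
     (let e = frame g in
       \<Sum>i<DIM('v). \<Sum>j<DIM('v). S [e ! i] [e ! j] * T [e ! i] [e ! j])"

definition einstein_lovelock ::
    "('v::euclidean_space \<Rightarrow> 'v \<Rightarrow> real) \<Rightarrow> 'v dform \<Rightarrow> nat \<Rightarrow> 'v dform" where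
  "einstein_lovelock g R k =
     (let m = DIM('v) - 2 * k - 1 in
       df_hodge g (df_scale (1 / fact m) (df_prod (df_power (df_bilinear g) m) (df_power R k))))"


section \<open>Riemannian geometry in local coordinates\<close>

definition pd :: "'n::finite \<Rightarrow> (real^'n \<Rightarrow> 'b::real_normed_vector) \<Rightarrow> real^'n \<Rightarrow> 'b" where
  "pd i f u = frechet_derivative f (at u) (axis i 1)"

text \<open>
  A Riemannian metric on an open set of \<open>real^'n\<close> is given by its matrix
  \<open>u \<mapsto> (g\<^sub>i\<^sub>j(u))\<close> in the coordinate basis. Everything in this section
  depends on \<open>g\<close> alone (and on the given function, for the Hessian).
\<close>

definition metric_at :: "(real^'n \<Rightarrow> real^'n^'n) \<Rightarrow> real^'n \<Rightarrow> real^'n \<Rightarrow> real^'n \<Rightarrow> real" where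
  "metric_at g u a b = (\<Sum>i\<in>UNIV. \<Sum>j\<in>UNIV. g u $ i $ j * a $ i * b $ j)"

text \<open>The Christoffel symbols \<open>\<Gamma>\<^sup>l\<^sub>i\<^sub>j\<close> of the Levi-Civita connection.\<close>

definition christoffel :: "(real^'n::finite \<Rightarrow> real^'n^'n) \<Rightarrow> 'n \<Rightarrow> 'n \<Rightarrow> 'n \<Rightarrow> real^'n \<Rightarrow> real" where
  "christoffel g l i j u =
     (1/2) * (\<Sum>m\<in>UNIV. matrix_inv (g u) $ l $ m *
        (pd i (\<lambda>w. g w $ j $ m) u + pd j (\<lambda>w. g w $ i $ m) u - pd m (\<lambda>w. g w $ i $ j) u))"

text \<open>
  The coefficient of \<open>\<partial>\<^sub>l\<close> in \<open>R(\<partial>\<^sub>i, \<partial>\<^sub>j)\<partial>\<^sub>m\<close>, where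
  \<open>R(X,Y)Z = \<nabla>\<^sub>X \<nabla>\<^sub>Y Z - \<nabla>\<^sub>Y \<nabla>\<^sub>X Z - \<nabla>\<^sub>[\<^sub>X\<^sub>,\<^sub>Y\<^sub>] Z\<close>.
\<close>

definition riemann_coeff ::
    "(real^'n::finite \<Rightarrow> real^'n^'n) \<Rightarrow> 'n \<Rightarrow> 'n \<Rightarrow> 'n \<Rightarrow> 'n \<Rightarrow> real^'n \<Rightarrow> real" where
  "riemann_coeff g l i j m u =
     pd i (christoffel g l j m) u - pd j (christoffel g l i m) u +
     (\<Sum>r\<in>UNIV. christoffel g l i r u * christoffel g r j m u
             - christoffel g l j r u * christoffel g r i m u)"

text \<open>
  \<open>R(x \<and> y, z \<and> w) = g(R(x,y)w, z)\<close>, so that \<open>R(x \<and> y, x \<and> y)\<close> is the sectional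
  curvature for orthonormal \<open>x\<close>, \<open>y\<close>.
\<close>

definition riemann :: "(real^'n::finite \<Rightarrow> real^'n^'n) \<Rightarrow> real^'n \<Rightarrow> (real^'n) dform" where
  "riemann g u xs ys =
     (if length xs = 2 \<and> length ys = 2 then
        (\<Sum>i\<in>UNIV. \<Sum>j\<in>UNIV. \<Sum>k\<in>UNIV. \<Sum>m\<in>UNIV.
           xs ! 0 $ i * xs ! 1 $ j * ys ! 0 $ k * ys ! 1 $ m *
           (\<Sum>l\<in>UNIV. g u $ k $ l * riemann_coeff g l i j m u))
      else 0)"

definition hess :: "(real^'n::finite \<Rightarrow> real^'n^'n) \<Rightarrow> (real^'n \<Rightarrow> real) \<Rightarrow> real^'n \<Rightarrow>
    real^'n \<Rightarrow> real^'n \<Rightarrow> real" where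
  "hess g f u a b =
     (\<Sum>i\<in>UNIV. \<Sum>j\<in>UNIV. a $ i * b $ j *
        (pd i (pd j f) u - (\<Sum>l\<in>UNIV. christoffel g l i j u * pd l f u)))"

definition lovelock_operator ::
    "(real^'n::finite \<Rightarrow> real^'n^'n) \<Rightarrow> nat \<Rightarrow> (real^'n \<Rightarrow> real) \<Rightarrow> real^'n \<Rightarrow> real" where
  "lovelock_operator g k f u =
     - df_inner11 (metric_at g u)
         (einstein_lovelock (metric_at g u) (riemann g u) k)
         (df_bilinear (hess g f u))"


section \<open>Submanifolds of Euclidean space\<close>

text \<open>Meant for open \<open>S\<close>: \<open>k\<close> times continuously differentiable.\<close>

primrec Ck_on :: "nat \<Rightarrow> ('a::euclidean_space \<Rightarrow> 'b::real_normed_vector) \<Rightarrow> 'a set \<Rightarrow> bool" where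
  "Ck_on 0 f S \<longleftrightarrow> continuous_on S f"
| "Ck_on (Suc k) f S \<longleftrightarrow> (\<forall>x\<in>S. f differentiable (at x)) \<and>
     (\<forall>v. Ck_on k (\<lambda>x. frechet_derivative f (at x) v) S)"

definition smooth_on :: "('a::euclidean_space \<Rightarrow> 'b::real_normed_vector) \<Rightarrow> 'a set \<Rightarrow> bool" where
  "smooth_on f S \<longleftrightarrow> (\<forall>k. Ck_on k f S)"

definition local_param :: "(real^'m) set \<Rightarrow> (real^'n) set \<Rightarrow> (real^'n \<Rightarrow> real^'m) \<Rightarrow> bool" where
  "local_param M U \<phi> \<longleftrightarrow> open U \<and> smooth_on \<phi> U \<and>
     (\<forall>u\<in>U. inj (frechet_derivative \<phi> (at u))) \<and>
     openin (top_of_set M) (\<phi> ` U) \<and> (\<exists>\<psi>. homeomorphism U (\<phi> ` U) \<phi> \<psi>)"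

text \<open>The dimension \<open>n = CARD('n)\<close> enters through a type argument.\<close>

definition submanifold :: "'n::finite itself \<Rightarrow> (real^'m) set \<Rightarrow> bool" where
  "submanifold _ M \<longleftrightarrow>
     (\<forall>x\<in>M. \<exists>U (\<phi> :: real^'n \<Rightarrow> real^'m). local_param M U \<phi> \<and> x \<in> \<phi> ` U)"

text \<open>
  Tensors at the point \<open>\<phi> u\<close> of the submanifold are expressed on \<open>real^'n\<close>, which is
  identified with the tangent space by the derivative of \<open>\<phi>\<close> at \<open>u\<close>.
\<close>

definition tangent_space :: "(real^'n \<Rightarrow> real^'m) \<Rightarrow> real^'n \<Rightarrow> (real^'m) set" where
  "tangent_space \<phi> u = range (frechet_derivative \<phi> (at u))"

definition normal_space :: "(real^'n \<Rightarrow> real^'m) \<Rightarrow> real^'n \<Rightarrow> (real^'m) set" where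
  "normal_space \<phi> u = orthogonal_comp (tangent_space \<phi> u)"

definition induced_metric :: "(real^'n::finite \<Rightarrow> real^'m) \<Rightarrow> real^'n \<Rightarrow> real^'n^'n" where
  "induced_metric \<phi> u = (\<chi> i j. pd i \<phi> u \<bullet> pd j \<phi> u)"

definition normal_part :: "(real^'m) set \<Rightarrow> real^'m \<Rightarrow> real^'m" where
  "normal_part T x = (THE w. w \<in> orthogonal_comp T \<and> x - w \<in> T)"

text \<open>
  \<open>B(X,Y)\<close> is the normal part of the flat derivative \<open>D\<^sub>X Y\<close>; for the coordinate fields,
  \<open>D\<^sub>\<partial>\<^sub>i \<partial>\<^sub>j\<close> is the second partial derivative of \<open>\<phi>\<close>.
\<close>

definition second_fundamental_form ::
    "(real^'n::finite \<Rightarrow> real^'m) \<Rightarrow> real^'n \<Rightarrow> real^'n \<Rightarrow> real^'n \<Rightarrow> real^'m" where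
  "second_fundamental_form \<phi> u a b =
     (\<Sum>i\<in>UNIV. \<Sum>j\<in>UNIV.
        (a $ i * b $ j) *\<^sub>R normal_part (tangent_space \<phi> u) (pd i (pd j \<phi>) u))"

definition h_odd :: "(real^'n::finite \<Rightarrow> real^'m) \<Rightarrow> nat \<Rightarrow> real^'n \<Rightarrow> real^'m \<Rightarrow> real" where
  "h_odd \<phi> k u N =
     (let g = metric_at (induced_metric \<phi>) u; m = CARD('n) - 2 * k - 1 in
       df_hodge g
         (df_prod
           (df_prod (df_scale (1 / fact m) (df_power (df_bilinear g) m))
                    (df_power (riemann (induced_metric \<phi>) u) k))
           (df_bilinear (\<lambda>a b. second_fundamental_form \<phi> u a b \<bullet> N))) [] [])"

text \<open>
  The quantities \<open>h\<^sub>2\<^sub>k\<^sub>+\<^sub>1(N)\<close> and \<open>\<ell>\<^sub>2\<^sub>k(f)\<close> at a point do not depend on the local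
  parametrization used to compute them; their vanishing is required in all of them.
\<close>

definition minimal_2k :: "'n::finite itself \<Rightarrow> nat \<Rightarrow> (real^'m) set \<Rightarrow> bool" where
  "minimal_2k _ k M \<longleftrightarrow>
     (\<forall>U (\<phi> :: real^'n \<Rightarrow> real^'m). local_param M U \<phi> \<longrightarrow>
        (\<forall>u\<in>U. \<forall>N\<in>normal_space \<phi> u. h_odd \<phi> k u N = 0))"

definition ell_harmonic :: "'n::finite itself \<Rightarrow> nat \<Rightarrow> (real^'m) set \<Rightarrow> (real^'m \<Rightarrow> real) \<Rightarrow> bool" where
  "ell_harmonic _ k M f \<longleftrightarrow>
     (\<forall>U (\<phi> :: real^'n \<Rightarrow> real^'m). local_param M U \<phi> \<longrightarrow>
        (\<forall>u\<in>U. lovelock_operator (induced_metric \<phi>) k (f \<circ> \<phi>) u = 0))"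

definition coordinate_function :: "real^'m \<Rightarrow> real^'m \<Rightarrow> real" where
  "coordinate_function v x = v \<bullet> x"

end

theory Submission
  imports Defs
begin

text \<open>
  By Gauss' formula the Hessian of \<open>f\<^sub>v\<close> is \<open>\<langle>B, v\<rangle>\<close>, since the Christoffel symbols of the
  induced metric are the tangential part of the second derivatives of the parametrization.
  For any \<open>(n-1,n-1)\<close>-double form \<open>\<omega>\<close> and any bilinear form \<open>S\<close>, expansion in an orthonormal
  frame gives \<open>*(\<omega>S) = \<langle>*\<omega>, S\<rangle>\<close>. Taking \<open>\<omega> = g^(n-2k-1) R^k / (n-2k-1)!\<close> and
  \<open>S = \<langle>B, v\<rangle>\<close> yields \<open>\<ell>\<^sub>2\<^sub>k(f\<^sub>v) = -h\<^sub>2\<^sub>k\<^sub>+\<^sub>1(v)\<close>, and the right-hand side depends only on the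
  normal part of \<open>v\<close>.
\<close>

section \<open>Double forms in an orthonormal frame\<close>

text \<open>Gram-Schmidt with respect to \<open>g\<close>, adding one vector per induction step.
  While k is below the dimension, k vectors cannot span, so some \<open>x\<close> lies outside their
  span; removing its \<open>g\<close>-projection leaves a nonzero vector to normalise.\<close>

lemma orthonormal_list_exists:
  fixes g :: "'v::euclidean_space \<Rightarrow> 'v \<Rightarrow> real"
  assumes bil: "bilinear g" and sym: "\<And>x y. g x y = g y x" and pos: "\<And>x. x \<noteq> 0 \<Longrightarrow> g x x > 0"
  shows "k \<le> DIM('v) \<Longrightarrow>
    \<exists>e. length e = k \<and> (\<forall>i<k. \<forall>j<k. g (e ! i) (e ! j) = (if i = j then 1 else 0))"
proof (induction k)
  case 0
  then show ?case by simp
next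
  case (Suc k)
  then obtain e where len: "length e = k"
    and on: "\<And>i j. i < k \<Longrightarrow> j < k \<Longrightarrow> g (e ! i) (e ! j) = (if i = j then 1 else 0)"
    by auto
  have lin: "linear (\<lambda>x. g x y)" "linear (g y)" for y
    using bil by (auto simp: bilinear_def)
  have "dim (span (set e)) < DIM('v)"
    using dim_le_card[of "set e" "set e"] card_length[of e] Suc.prems len
    by (simp add: dim_span span_superset)
  then obtain x where x: "x \<notin> span (set e)"
    by (metis UNIV_eq_I dim_UNIV less_irrefl)
  define y where "y = x - (\<Sum>i<k. g x (e ! i) *\<^sub>R (e ! i))"
  have "y \<noteq> 0"
  proof
    assume "y = 0"
    then have "x = (\<Sum>i<k. g x (e ! i) *\<^sub>R (e ! i))" by (simp add: y_def)
    also have "\<dots> \<in> span (set e)"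
      using len by (auto intro!: span_sum span_scale intro: span_base)
    finally show False using x by simp
  qed
  have orth: "g y (e ! j) = 0" if "j < k" for j
  proof -
    have "g y (e ! j) = g x (e ! j) - (\<Sum>i<k. g x (e ! i) * g (e ! i) (e ! j))"
      unfolding y_def
      by (simp add: linear_diff[OF lin(1)] linear_sum[OF lin(1)] linear_scale[OF lin(1)])
    also have "(\<Sum>i<k. g x (e ! i) * g (e ! i) (e ! j)) = (\<Sum>i<k. if i = j then g x (e ! j) else 0)"
      by (rule sum.cong) (auto simp: on that)
    finally show ?thesis using that by simp
  qed
  define z where "z = (1 / sqrt (g y y)) *\<^sub>R y"
  have gyy: "g y y > 0" using pos \<open>y \<noteq> 0\<close> by blast
  have "g z z = g y y / (sqrt (g y y) * sqrt (g y y))"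
    by (simp add: z_def linear_scale[OF lin(1)] linear_scale[OF lin(2)])
  then have zz: "g z z = 1" using gyy by simp
  have ze: "g z (e ! j) = 0" "g (e ! j) z = 0" if "j < k" for j
    using orth[OF that] by (simp_all add: z_def linear_scale[OF lin(1)] linear_scale[OF lin(2)] sym[of "e ! j"])
  show ?case
    by (rule exI[of _ "e @ [z]"]) (auto simp: len nth_append less_Suc_eq on zz ze)
qed

lemma orthonormal_basis_frame:
  fixes g :: "'v::euclidean_space \<Rightarrow> 'v \<Rightarrow> real"
  assumes "bilinear g" "\<And>x y. g x y = g y x" "\<And>x. x \<noteq> 0 \<Longrightarrow> g x x > 0"
  shows "orthonormal_basis g (frame g)"
  unfolding frame_def
  by (rule someI_ex) (use orthonormal_list_exists[OF assms, of "DIM('v)"] in \<open>auto simp: orthonormal_basis_def\<close>)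

section \<open>Volume and Hodge coefficients of frame vectors\<close>

text \<open>On frame vectors every factor of the Leibniz sum is a Kronecker delta, so
  \<open>\<tau>\<close> is the only permutation whose product survives.\<close>

lemma volume_coeff_permuted:
  assumes e: "orthonormal_basis g e" and \<tau>: "\<tau> permutes {..<length e}"
    and xs: "\<And>i. i < length e \<Longrightarrow> xs ! i = e ! \<tau> i"
  shows "volume_coeff g e xs = of_int (sign \<tau>)"
proof -
  have "(\<Prod>i<length e. g (xs ! i) (e ! \<sigma> i)) = (if \<sigma> = \<tau> then 1 else 0)"
    if \<sigma>: "\<sigma> permutes {..<length e}" for \<sigma>
  proof -
    have lt: "\<tau> i < length e" "\<sigma> i < length e" if "i < length e" for i
      using permutes_in_image[OF \<tau>] permutes_in_image[OF \<sigma>] that by auto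
    have "(\<Prod>i<length e. g (xs ! i) (e ! \<sigma> i)) = (\<Prod>i<length e. if \<tau> i = \<sigma> i then 1 else 0)"
      using e lt by (intro prod.cong) (auto simp: xs orthonormal_basis_def)
    also have "\<dots> = (if \<sigma> = \<tau> then 1 else 0)"
    proof (cases "\<sigma> = \<tau>")
      case False
      then obtain i where "\<sigma> i \<noteq> \<tau> i" by blast
      moreover from this have "i < length e"
        using permutes_not_in[OF \<tau>, of i] permutes_not_in[OF \<sigma>, of i] by (cases "i < length e") auto
      ultimately show ?thesis using False by (auto intro!: prod_zero)
    qed simp
    finally show ?thesis .
  qed
  then have "volume_coeff g e xs =
      (\<Sum>\<sigma> | \<sigma> permutes {..<length e}. if \<sigma> = \<tau> then of_int (sign \<tau>) else 0)"
    unfolding volume_coeff_def by (intro sum.cong) auto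
  also have "\<dots> = of_int (sign \<tau>)"
    using \<tau> finite_permutations[of "{..<length e}"] by (simp add: sum.delta)
  finally show ?thesis .
qed

text \<open>No cancellation between permutations is involved: \<open>\<sigma> a\<close> and
  \<open>\<sigma> b\<close> differ, so at least one of them is not \<open>c\<close>, and the
  corresponding factor makes each summand zero by itself.\<close>

lemma volume_coeff_repeated:
  assumes e: "orthonormal_basis g e" and "a < length e" "b < length e" "a \<noteq> b"
    and "c < length e" "xs ! a = e ! c" "xs ! b = e ! c"
  shows "volume_coeff g e xs = 0"
  unfolding volume_coeff_def
proof (rule sum.neutral, safe)
  fix \<sigma> assume \<sigma>: "\<sigma> permutes {..<length e}"
  have lt: "\<sigma> a < length e" "\<sigma> b < length e"
    using permutes_in_image[OF \<sigma>] assms by auto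
  have "\<sigma> a \<noteq> \<sigma> b"
    using permutes_inj[OF \<sigma>] assms by (auto dest: injD)
  then have "g (xs ! a) (e ! \<sigma> a) = 0 \<or> g (xs ! b) (e ! \<sigma> b) = 0"
    using e assms lt by (auto simp: orthonormal_basis_def)
  then obtain d where "d < length e" "g (xs ! d) (e ! \<sigma> d) = 0"
    using assms by blast
  then have "(\<Prod>i<length e. g (xs ! i) (e ! \<sigma> i)) = 0"
    by (intro prod_zero) auto
  then show "of_int (sign \<sigma>) * (\<Prod>i<length e. g (xs ! i) (e ! \<sigma> i)) = 0" by simp
qed

text \<open>The cycle with list of images i, 0, ..., i-1, i+1, ..., which rearranges a frame into
  \<open>e ! i\<close> followed by the other vectors in order. Building it from i adjacent
  transpositions yields its sign by induction.\<close>

primrec to_front :: "nat \<Rightarrow> nat \<Rightarrow> nat" where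
  "to_front 0 = id"
| "to_front (Suc i) = Transposition.transpose i (Suc i) \<circ> to_front i"

lemma to_front_apply: "to_front i a = (if a = 0 then i else if a \<le> i then a - 1 else a)"
  by (induction i arbitrary: a) (auto simp: Transposition.transpose_def)

lemma to_front_permutes: "i < n \<Longrightarrow> to_front i permutes {..<n}"
  by (induction i) (auto simp: permutes_id intro!: permutes_compose permutes_swap_id)

lemma sign_to_front: "sign (to_front i) = (-1) ^ i"
proof (induction i)
  case (Suc i)
  have "permutation (to_front i)"
    using to_front_permutes[of i "Suc i"] by (auto intro: permutes_imp_permutation)
  then have "sign (Transposition.transpose i (Suc i) \<circ> to_front i) = - sign (to_front i)"
    by (subst sign_compose) (auto simp: permutation_swap_id sign_swap_id)
  then show ?case
    using Suc by (simp only: to_front.simps power_Suc)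
qed simp

lemma nths_remove_index:
  assumes "i < length xs"
  shows "nths xs ({..<length xs} - {i}) = take i xs @ drop (Suc i) xs"
  using assms
proof (induction xs arbitrary: i)
  case (Cons x xs)
  show ?case
  proof (cases i)
    case 0
    have "{j. Suc j \<in> {..<length (x # xs)} - {i}} = {..<length xs}" using 0 by auto
    then show ?thesis using 0 by (simp add: nths_Cons)
  next
    case (Suc k)
    have "{j. Suc j \<in> {..<length (x # xs)} - {i}} = {..<length xs} - {k}" using Suc by auto
    then show ?thesis using Suc Cons by (simp add: nths_Cons)
  qed
qed simp

lemma nths_complement_remove_index:
  assumes "i < length xs"
  shows "nths xs (- ({..<length xs} - {i})) = [xs ! i]"
  using assms
proof (induction xs arbitrary: i)
  case (Cons x xs)
  show ?case
  proof (cases i)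
    case 0
    have "length (nths xs {j. Suc j \<in> - ({..<length (x # xs)} - {i})}) = 0"
      unfolding length_nths using 0 by (simp add: card_eq_0_iff)
    then show ?thesis using 0 by (simp add: nths_Cons)
  next
    case (Suc k)
    have "{j. Suc j \<in> - ({..<length (x # xs)} - {i})} = - ({..<length xs} - {k})" using Suc by auto
    then show ?thesis using Suc Cons by (simp add: nths_Cons)
  qed
qed simp

text \<open>Up to sign, the star of a frame vector is the wedge of all the others. For i = j the
  concatenated list is the frame rearranged by \<open>to_front i\<close>; for different i and j the
  vector \<open>e ! i\<close> occurs twice in it.\<close>

lemma hodge_coeff_frame:
  assumes e: "orthonormal_basis g e" and i: "i < length e" and j: "j < length e"
  shows "hodge_coeff g e [e ! i] ({..<length e} - {j}) = (if i = j then (-1) ^ i else 0)"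
proof (cases "i = j")
  case True
  have "volume_coeff g e (e ! i # take i e @ drop (Suc i) e) = of_int (sign (to_front i))"
    by (rule volume_coeff_permuted[OF e to_front_permutes[OF i]])
      (auto simp: to_front_apply nth_Cons' nth_append min_def i)
  then show ?thesis
    using True i by (simp add: hodge_coeff_def nths_remove_index sign_to_front)
next
  case False
  let ?ys = "nths e ({..<length e} - {j})"
  have len: "length ?ys = length e - 1" using j by (simp add: nths_remove_index)
  have "e ! i \<in> set ?ys" using False i by (auto simp: set_nths)
  then obtain b where "b < length ?ys" "?ys ! b = e ! i" by (auto simp: in_set_conv_nth)
  then have "volume_coeff g e (e ! i # ?ys) = 0"
    using e i len by (intro volume_coeff_repeated[where a = 0 and b = "Suc b" and c = i]) auto
  then show ?thesis using False by (simp add: hodge_coeff_def)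
qed

lemma hodge_coeff_full:
  assumes e: "orthonormal_basis g e"
  shows "hodge_coeff g e [] {..<length e} = 1"
  using volume_coeff_permuted[OF e permutes_id, of e]
  by (simp add: hodge_coeff_def nths_upt_eq_take)

section \<open>Omitting one index, and products with a bilinear form\<close>

lemma corank_one_subsets:
  "{J. J \<subseteq> {..<n} \<and> Suc (card J) = n} = (\<lambda>i. {..<n} - {i}) ` {..<n}"
proof (intro subset_antisym subsetI)
  fix J assume "J \<in> {J. J \<subseteq> {..<n} \<and> Suc (card J) = n}"
  then have J: "J \<subseteq> {..<n}" "Suc (card J) = n" by auto
  have "card ({..<n} - J) = 1"
    using card_Diff_subset[OF finite_subset[OF J(1)] J(1)] J(2)[symmetric] by simp
  then obtain i where "{..<n} - J = {i}" by (auto simp: card_1_singleton_iff)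
  then have "J = {..<n} - {i}" "i < n" using J(1) by auto
  then show "J \<in> (\<lambda>i. {..<n} - {i}) ` {..<n}" by blast
qed auto

lemma sum_corank_one_subsets:
  fixes F :: "nat set \<Rightarrow> 'a::comm_monoid_add"
  shows "(\<Sum>J | J \<subseteq> {..<n} \<and> Suc (card J) = n. F J) = (\<Sum>i<n. F ({..<n} - {i}))"
  unfolding corank_one_subsets
  by (subst sum.reindex) (auto simp: inj_on_def)

lemma sum_Pow_corank_one:
  fixes F :: "nat set \<Rightarrow> 'a::comm_monoid_add"
  assumes "\<And>I. I \<subseteq> {..<n} \<Longrightarrow> Suc (card I) \<noteq> n \<Longrightarrow> F I = 0"
  shows "(\<Sum>I\<in>Pow {..<n}. F I) = (\<Sum>i<n. F ({..<n} - {i}))"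
proof -
  have "(\<Sum>I\<in>Pow {..<n}. F I) = (\<Sum>J | J \<subseteq> {..<n} \<and> Suc (card J) = n. F J)"
    using assms by (intro sum.mono_neutral_right) auto
  then show ?thesis by (simp add: sum_corank_one_subsets)
qed

text \<open>The omitted position i is inverted exactly with the n - 1 - i positions after
  it.\<close>

lemma shuffle_sign_remove:
  assumes "i < n"
  shows "shuffle_sign ({..<n} - {i}) = (-1) ^ (n - Suc i)"
proof -
  have "{(a, b). a \<in> {..<n} - {i} \<and> b \<notin> {..<n} - {i} \<and> b < a} = {i<..<n} \<times> {i}"
    using assms by auto
  then show ?thesis by (simp add: shuffle_sign_def card_cartesian_product)
qed

lemma length_nths_complement:
  assumes "I \<subseteq> {..<length xs}"
  shows "length (nths xs (- I)) = length xs - card I"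
proof -
  have "{i. i < length xs \<and> i \<in> - I} = {..<length xs} - I" by auto
  then show ?thesis
    using assms by (simp add: length_nths card_Diff_subset finite_subset[of I "{..<length xs}"])
qed

text \<open>A bilinear form accepts one vector on each side, so only the shuffles that leave a
  single position out of each list contribute. This is a Laplace expansion carried out
  simultaneously in both factors.\<close>

lemma df_prod_bilinear:
  "df_prod \<omega> (df_bilinear B) xs ys =
     (\<Sum>i<length xs. \<Sum>j<length ys. (-1) ^ (length xs - Suc i) * (-1) ^ (length ys - Suc j) *
        \<omega> (nths xs ({..<length xs} - {i})) (nths ys ({..<length ys} - {j})) * B (xs ! i) (ys ! j))"
proof -
  have vanish: "df_bilinear B (nths xs (- I)) (nths ys (- J)) = 0"
    if "I \<subseteq> {..<length xs}" "J \<subseteq> {..<length ys}"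
      "Suc (card I) \<noteq> length xs \<or> Suc (card J) \<noteq> length ys" for I J
    using that by (auto simp: df_bilinear_def length_nths_complement)
  define F where "F I J = shuffle_sign I * shuffle_sign J * \<omega> (nths xs I) (nths ys J) *
      df_bilinear B (nths xs (- I)) (nths ys (- J))" for I J
  have F0: "F I J = 0" if "I \<subseteq> {..<length xs}" "J \<subseteq> {..<length ys}"
    "Suc (card I) \<noteq> length xs \<or> Suc (card J) \<noteq> length ys" for I J
    by (simp add: F_def vanish[OF that])
  have "df_prod \<omega> (df_bilinear B) xs ys =
      (\<Sum>I\<in>Pow {..<length xs}. \<Sum>J\<in>Pow {..<length ys}. F I J)"
    by (simp add: df_prod_def F_def)
  \<comment> \<open>The inner sum is reduced for every I first; afterwards an I of the wrong size
    has only zero summands left.\<close>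
  also have "\<dots> = (\<Sum>I\<in>Pow {..<length xs}. \<Sum>j<length ys. F I ({..<length ys} - {j}))"
    by (intro sum.cong refl sum_Pow_corank_one F0) auto
  also have "\<dots> = (\<Sum>i<length xs. \<Sum>j<length ys. F ({..<length xs} - {i}) ({..<length ys} - {j}))"
    by (intro sum_Pow_corank_one sum.neutral ballI F0) auto
  also have "\<dots> = (\<Sum>i<length xs. \<Sum>j<length ys.
      (-1) ^ (length xs - Suc i) * (-1) ^ (length ys - Suc j) *
        \<omega> (nths xs ({..<length xs} - {i})) (nths ys ({..<length ys} - {j})) * B (xs ! i) (ys ! j))"
  proof (intro sum.cong refl)
    fix i j assume "i \<in> {..<length xs}" "j \<in> {..<length ys}"
    then have ij: "i < length xs" "j < length ys" by auto
    show "F ({..<length xs} - {i}) ({..<length ys} - {j}) =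
        (-1) ^ (length xs - Suc i) * (-1) ^ (length ys - Suc j) *
        \<omega> (nths xs ({..<length xs} - {i})) (nths ys ({..<length ys} - {j})) * B (xs ! i) (ys ! j)"
      unfolding F_def nths_complement_remove_index[OF ij(1)] nths_complement_remove_index[OF ij(2)]
      by (simp add: shuffle_sign_remove ij df_bilinear_def)
  qed
  finally show ?thesis .
qed

lemma df_prod_scale_left: "df_prod (df_scale c \<omega>) \<eta> = df_scale c (df_prod \<omega> \<eta>)"
  by (intro ext) (simp add: df_prod_def df_scale_def sum_distrib_left mult_ac)

section \<open>The Hodge star evaluated on a frame\<close>

text \<open>With p = q = n the sign exponent is -2 n^2, an even integer, and the full index set is
  the only one of size n.\<close>

lemma df_hodge_scalar:
  fixes g :: "'v::euclidean_space \<Rightarrow> 'v \<Rightarrow> real"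
  assumes e: "orthonormal_basis g (frame g)"
  shows "df_hodge g \<omega> [] [] = \<omega> (frame g) (frame g)"
proof -
  have len: "length (frame g) = DIM('v)" using e by (simp add: orthonormal_basis_def)
  have J: "{J. J \<subseteq> {..<DIM('v)} \<and> card J = DIM('v)} = {{..<DIM('v)}}"
    using card_subset_eq[of "{..<DIM('v)}"] by auto
  show ?thesis
    using hodge_coeff_full[OF e]
    by (simp add: df_hodge_def Let_def len J nths_upt_eq_take power_int_minus_one_mult_self)
qed

text \<open>With p = q = n - 1 the sum p + q is even, so the prefactor of the star is 1. The
  remaining signs come from the two Hodge coefficients, which single out one term of the double
  sum.\<close>

lemma df_hodge_frame:
  fixes g :: "'v::euclidean_space \<Rightarrow> 'v \<Rightarrow> real"
  defines "e \<equiv> frame g" and "n \<equiv> DIM('v)"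
  assumes e: "orthonormal_basis g e" and ij: "i < n" "j < n"
  shows "df_hodge g \<omega> [e ! i] [e ! j] =
    (-1) ^ i * (-1) ^ j * \<omega> (nths e ({..<n} - {i})) (nths e ({..<n} - {j}))"
proof -
  have len: "length e = n" using e by (simp add: orthonormal_basis_def n_def)
  have "(\<Sum>J | J \<subseteq> {..<n} \<and> Suc (card J) = n. \<Sum>K | K \<subseteq> {..<n} \<and> Suc (card K) = n.
          hodge_coeff g e [e ! i] J * hodge_coeff g e [e ! j] K * \<omega> (nths e J) (nths e K)) =
      (\<Sum>a<n. \<Sum>b<n. hodge_coeff g e [e ! i] ({..<n} - {a}) * hodge_coeff g e [e ! j] ({..<n} - {b}) *
          \<omega> (nths e ({..<n} - {a})) (nths e ({..<n} - {b})))"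
    by (simp add: sum_corank_one_subsets)
  also have "\<dots> = (\<Sum>a<n. \<Sum>b<n. if b = j then (if a = i then (-1) ^ i * (-1) ^ j *
          \<omega> (nths e ({..<n} - {i})) (nths e ({..<n} - {j})) else 0) else 0)"
    using hodge_coeff_frame[OF e] ij len by (intro sum.cong) auto
  also have "\<dots> = (-1) ^ i * (-1) ^ j * \<omega> (nths e ({..<n} - {i})) (nths e ({..<n} - {j}))"
    using ij by simp
  finally show ?thesis
    by (simp add: df_hodge_def Let_def e_def[symmetric] n_def[symmetric] power_int_minus_left)
qed

text \<open>The adjointness behind the theorem. Evaluating the product on the full frame and pairing
  the starred form with \<open>B\<close> produce the same double sum over omitted indices i and j,
  once the signs are matched.\<close>

lemma df_hodge_prod_bilinear:
  fixes g :: "'v::euclidean_space \<Rightarrow> 'v \<Rightarrow> real"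
  assumes e: "orthonormal_basis g (frame g)"
  shows "df_hodge g (df_prod \<omega> (df_bilinear B)) [] [] =
    df_inner11 g (df_hodge g \<omega>) (df_bilinear B)"
proof -
  have len: "length (frame g) = DIM('v)" using e by (simp add: orthonormal_basis_def)
  \<comment> \<open>Shuffle signs put the omitted vector last, Hodge signs put it first. Each pair
    differs by (-1)^(n-1), which occurs once per factor and hence squares to 1.\<close>
  have sgn: "(-1) ^ (n - Suc i) * (-1) ^ (n - Suc j) = (-1::real) ^ i * (-1) ^ j"
    if "i < n" "j < n" for i j n
  proof -
    have "even ((n - Suc i) + (n - Suc j)) \<longleftrightarrow> even (i + j)" using that by auto
    then show ?thesis unfolding power_add[symmetric] by (simp add: minus_one_power_iff)
  qed
  show ?thesis
    unfolding df_hodge_scalar[OF e] df_prod_bilinear df_inner11_def Let_def len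
    by (intro sum.cong refl)
      (simp add: df_hodge_frame[OF e] sgn df_bilinear_def)
qed

section \<open>Symmetry of second derivatives\<close>

text \<open>The mean value theorem is applied twice, first along \<open>a\<close> and then along
  \<open>b\<close>. The bound on \<open>h\<close> keeps the whole parallelogram spanned by
  \<open>h a\<close> and \<open>h b\<close> inside the ball.\<close>

lemma second_difference_mean_value:
  fixes f :: "'a::real_normed_vector \<Rightarrow> real"
  assumes f': "\<And>x. x \<in> ball u r \<Longrightarrow> (f has_derivative f' x) (at x)"
    and f'': "\<And>x. x \<in> ball u r \<Longrightarrow> ((\<lambda>x. f' x a) has_derivative f'' x) (at x)"
    and h: "0 < h" "h * (norm a + norm b) < r"
  obtains p where "dist u p \<le> h * (norm a + norm b)"
    "f (u + h *\<^sub>R a + h *\<^sub>R b) - f (u + h *\<^sub>R a) - f (u + h *\<^sub>R b) + f u = h * h * f'' p b"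
proof -
  have near: "dist u (u + s *\<^sub>R a + t *\<^sub>R b) \<le> h * (norm a + norm b)"
    if "0 \<le> s" "s \<le> h" "0 \<le> t" "t \<le> h" for s t
  proof -
    have "dist u (u + s *\<^sub>R a + t *\<^sub>R b) = norm (s *\<^sub>R a + t *\<^sub>R b)"
      by (metis add.assoc dist_norm norm_minus_commute add_diff_cancel_left')
    also have "\<dots> \<le> s * norm a + t * norm b"
      using norm_triangle_ineq[of "s *\<^sub>R a" "t *\<^sub>R b"] that by simp
    also have "\<dots> \<le> h * (norm a + norm b)"
      using that by (simp add: distrib_left add_mono mult_right_mono)
    finally show ?thesis .
  qed
  have inball: "u + s *\<^sub>R a + t *\<^sub>R b \<in> ball u r" if "0 \<le> s" "s \<le> h" "0 \<le> t" "t \<le> h" for s t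
    using near[OF that] h by simp
  \<comment> \<open>\<open>G\<close> is the increment along \<open>b\<close> as its base point moves
    along \<open>a\<close>, so \<open>G h - G 0\<close> is the second difference.\<close>
  define G where "G s = f (u + s *\<^sub>R a + h *\<^sub>R b) - f (u + s *\<^sub>R a)" for s
  have Gder: "(G has_real_derivative (f' (u + s *\<^sub>R a + h *\<^sub>R b) a - f' (u + s *\<^sub>R a) a)) (at s)"
    if s: "0 \<le> s" "s \<le> h" for s
  proof -
    have "((\<lambda>s. f (u + s *\<^sub>R a + t *\<^sub>R b)) has_derivative (\<lambda>c. f' (u + s *\<^sub>R a + t *\<^sub>R b) (c *\<^sub>R a))) (at s)"
      if "0 \<le> t" "t \<le> h" for t
    proof -
      have "((\<lambda>s. u + s *\<^sub>R a + t *\<^sub>R b) has_derivative (\<lambda>c. c *\<^sub>R a)) (at s)"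
        by (auto intro!: derivative_eq_intros)
      from has_derivative_compose[OF this f'[OF inball[OF s that]]] show ?thesis .
    qed
    from this[of h] this[of 0] h(1)
    have "(G has_derivative (\<lambda>c. f' (u + s *\<^sub>R a + h *\<^sub>R b) (c *\<^sub>R a) - f' (u + s *\<^sub>R a) (c *\<^sub>R a))) (at s)"
      unfolding G_def by (auto intro!: has_derivative_diff)
    moreover have scale: "f' x (c *\<^sub>R a) = f' x a * c" if "x \<in> ball u r" for x c
      using linear_scale[OF has_derivative_linear[OF f'[OF that]]] by (simp add: mult.commute)
    have "u + s *\<^sub>R a + h *\<^sub>R b \<in> ball u r" "u + s *\<^sub>R a \<in> ball u r"
      using inball[OF s, of h] inball[OF s, of 0] h(1) by simp_all
    then have "(\<lambda>c. f' (u + s *\<^sub>R a + h *\<^sub>R b) (c *\<^sub>R a) - f' (u + s *\<^sub>R a) (c *\<^sub>R a)) =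
        (*) (f' (u + s *\<^sub>R a + h *\<^sub>R b) a - f' (u + s *\<^sub>R a) a)"
      by (simp add: fun_eq_iff scale left_diff_distrib del: mem_ball)
    ultimately show ?thesis by (simp only: has_field_derivative_def)
  qed
  obtain s where s: "0 < s" "s < h"
    "G h - G 0 = (h - 0) * (f' (u + s *\<^sub>R a + h *\<^sub>R b) a - f' (u + s *\<^sub>R a) a)"
    using MVT2[OF h(1) Gder] by blast
  have Hder: "((\<lambda>t. f' (u + s *\<^sub>R a + t *\<^sub>R b) a) has_real_derivative f'' (u + s *\<^sub>R a + t *\<^sub>R b) b) (at t)"
    if t: "0 \<le> t" "t \<le> h" for t
  proof -
    have x: "u + s *\<^sub>R a + t *\<^sub>R b \<in> ball u r" using inball s t by simp
    have "((\<lambda>t. u + s *\<^sub>R a + t *\<^sub>R b) has_derivative (\<lambda>c. c *\<^sub>R b)) (at t)"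
      by (auto intro!: derivative_eq_intros)
    note has_derivative_compose[OF this f''[OF x]]
    moreover have "(\<lambda>c. f'' (u + s *\<^sub>R a + t *\<^sub>R b) (c *\<^sub>R b)) =
        (*) (f'' (u + s *\<^sub>R a + t *\<^sub>R b) b)"
      using linear_scale[OF has_derivative_linear[OF f''[OF x]]] by (simp add: fun_eq_iff)
    ultimately show ?thesis by (simp only: has_field_derivative_def)
  qed
  obtain t where t: "0 < t" "t < h"
    "f' (u + s *\<^sub>R a + h *\<^sub>R b) a - f' (u + s *\<^sub>R a + 0 *\<^sub>R b) a = (h - 0) * f'' (u + s *\<^sub>R a + t *\<^sub>R b) b"
    using MVT2[OF h(1) Hder] by blast
  show thesis
  proof (rule that)
    show "dist u (u + s *\<^sub>R a + t *\<^sub>R b) \<le> h * (norm a + norm b)"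
      using near s t by simp
    show "f (u + h *\<^sub>R a + h *\<^sub>R b) - f (u + h *\<^sub>R a) - f (u + h *\<^sub>R b) + f u =
        h * h * f'' (u + s *\<^sub>R a + t *\<^sub>R b) b"
      using s(3) t(3) by (simp add: G_def)
  qed
qed

text \<open>The second difference is symmetric in \<open>a\<close> and \<open>b\<close>, so the two
  mixed derivatives agree at some points p and q near u. If they differed at u, continuity would
  contradict this for a small step.\<close>

lemma symmetric_second_derivative_real:
  fixes f :: "'a::real_normed_vector \<Rightarrow> real"
  assumes "open S" "u \<in> S"
    and f': "\<And>x. x \<in> S \<Longrightarrow> (f has_derivative f' x) (at x)"
    and f'': "\<And>x c. x \<in> S \<Longrightarrow> ((\<lambda>x. f' x c) has_derivative f'' c x) (at x)"
    and cont: "\<And>c d. continuous_on S (\<lambda>x. f'' c x d)"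
  shows "f'' a u b = f'' b u a"
proof (rule ccontr)
  assume ne: "f'' a u b \<noteq> f'' b u a"
  define \<epsilon> where "\<epsilon> = \<bar>f'' a u b - f'' b u a\<bar> / 2"
  have \<epsilon>: "\<epsilon> > 0" using ne by (simp add: \<epsilon>_def)
  have lim: "isCont (\<lambda>x. f'' c x d) u" for c d
    using cont assms(1,2) continuous_on_eq_continuous_at by blast
  obtain d1 where d1: "d1 > 0" "\<And>x. dist x u < d1 \<Longrightarrow> dist (f'' a x b) (f'' a u b) < \<epsilon>"
    using lim[of a b] \<epsilon> unfolding continuous_at_eps_delta by blast
  obtain d2 where d2: "d2 > 0" "\<And>x. dist x u < d2 \<Longrightarrow> dist (f'' b x a) (f'' b u a) < \<epsilon>"
    using lim[of b a] \<epsilon> unfolding continuous_at_eps_delta by blast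
  obtain r0 where r0: "r0 > 0" "ball u r0 \<subseteq> S"
    using assms(1,2) open_contains_ball by blast
  define r where "r = min r0 (min d1 d2)"
  have r: "r > 0" "ball u r \<subseteq> S" using r0 d1 d2 by (auto simp: r_def)
  \<comment> \<open>The summand 1 keeps the denominator positive even when both directions
    vanish.\<close>
  define h where "h = r / (2 * (norm a + norm b + 1))"
  have den: "0 < norm a + norm b + 1" by (smt (verit) norm_ge_zero)
  have h: "h > 0" "h * (norm a + norm b) < r" 
  proof -
    show "h > 0" using r den by (simp add: h_def)
    then have "h * (norm a + norm b) < h * (norm a + norm b + 1)" by simp
    also have "\<dots> = r / 2" using den by (simp add: h_def field_simps)
    finally show "h * (norm a + norm b) < r" using r by simp
  qed
  obtain p where p: "dist u p \<le> h * (norm a + norm b)"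
    "f (u + h *\<^sub>R a + h *\<^sub>R b) - f (u + h *\<^sub>R a) - f (u + h *\<^sub>R b) + f u = h * h * f'' a p b"
    using second_difference_mean_value[of u r f f' a "f'' a" h b] f' f'' r h by blast
  obtain q where q: "dist u q \<le> h * (norm b + norm a)"
    "f (u + h *\<^sub>R b + h *\<^sub>R a) - f (u + h *\<^sub>R b) - f (u + h *\<^sub>R a) + f u = h * h * f'' b q a"
    using second_difference_mean_value[of u r f f' b "f'' b" h a] f' f'' r h
    by (metis add.commute subsetD)
  have "u + h *\<^sub>R b + h *\<^sub>R a = u + h *\<^sub>R a + h *\<^sub>R b" by (simp add: algebra_simps)
  then have "h * h * f'' a p b = h * h * f'' b q a"
    using p(2) q(2) by (simp add: algebra_simps)
  then have eq: "f'' a p b = f'' b q a" using h by simp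
  have "dist (f'' a p b) (f'' a u b) < \<epsilon>"
    using p h by (intro d1) (simp add: r_def dist_commute)
  moreover have "dist (f'' b q a) (f'' b u a) < \<epsilon>"
    using q h by (intro d2) (simp add: r_def dist_commute add.commute)
  \<comment> \<open>A common value would lie within less than half the gap of both numbers.\<close>
  ultimately show False using eq unfolding dist_real_def \<epsilon>_def by (smt (verit) field_sum_of_halves)
qed

text \<open>A vector is determined by its inner products, so the real case applied to each
  \<open>f x \<bullet> w\<close> suffices.\<close>

lemma symmetric_second_derivative:
  fixes f :: "'a::real_normed_vector \<Rightarrow> 'b::real_inner"
  assumes "open S" "u \<in> S"
    and f': "\<And>x. x \<in> S \<Longrightarrow> (f has_derivative f' x) (at x)"
    and f'': "\<And>x c. x \<in> S \<Longrightarrow> ((\<lambda>x. f' x c) has_derivative f'' c x) (at x)"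
    and cont: "\<And>c d. continuous_on S (\<lambda>x. f'' c x d)"
  shows "f'' a u b = f'' b u a"
proof -
  have "f'' a u b \<bullet> w = f'' b u a \<bullet> w" for w
    by (rule symmetric_second_derivative_real[OF assms(1,2), where f = "\<lambda>x. f x \<bullet> w"
          and f' = "\<lambda>x c. f' x c \<bullet> w" and f'' = "\<lambda>c x d. f'' c x d \<bullet> w"])
      (auto intro!: has_derivative_inner_left f' f'' continuous_intros cont)
  then show ?thesis by (metis inner_commute vector_eq_rdot)
qed

section \<open>Immersions into Euclidean space\<close>

lemma pd_has_derivative: "(f has_derivative D) (at u) \<Longrightarrow> pd i f u = D (axis i 1)"
  unfolding pd_def using frechet_derivative_at by metis

lemma linear_axis_expansion:
  fixes L :: "real^'n::finite \<Rightarrow> 'b::real_vector"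
  assumes "linear L"
  shows "L a = (\<Sum>i\<in>UNIV. a $ i *\<^sub>R L (axis i 1))"
proof -
  have "L a = L (\<Sum>i\<in>UNIV. a $ i *s axis i 1)" by (simp add: basis_expansion)
  then show ?thesis
    by (simp add: linear_sum[OF assms] linear_scale[OF assms] scalar_mult_eq_scaleR)
qed

text \<open>Two candidates differ by a vector lying both in \<open>T\<close> and in its orthogonal
  complement, hence by zero. This makes the definite description computable.\<close>

lemma normal_part_eqI:
  assumes T: "subspace T" and w: "w \<in> orthogonal_comp T" "x - w \<in> T"
  shows "normal_part T x = w"
  unfolding normal_part_def
proof (rule the_equality)
  fix w' assume w': "w' \<in> orthogonal_comp T \<and> x - w' \<in> T"
  have "(x - w) - (x - w') \<in> T" using T w w' by (blast intro: subspace_diff)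
  moreover have "w' - w \<in> orthogonal_comp T"
    using w w' by (blast intro: subspace_diff subspace_orthogonal_comp)
  ultimately have "(w' - w) \<bullet> (w' - w) = 0"
    by (auto simp: orthogonal_comp_def orthogonal_def)
  then show "w' = w" by simp
qed (use w in auto)

lemma normal_part_exists:
  assumes "subspace T"
  shows "normal_part T x \<in> orthogonal_comp T" "x - normal_part T x \<in> T"
proof -
  obtain y z where yz: "y \<in> span T" "\<And>w. w \<in> span T \<Longrightarrow> orthogonal z w" "x = y + z"
    using orthogonal_subspace_decomp_exists[of T x] by metis
  have "normal_part T x = z"
  proof (rule normal_part_eqI[OF assms])
    show "z \<in> orthogonal_comp T"
      using yz(2) span_base[of _ T] by (auto simp: orthogonal_comp_def orthogonal_commute)
    show "x - z \<in> T" using yz assms by (simp add: span_eq_iff[THEN iffD2])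
  qed
  then show "normal_part T x \<in> orthogonal_comp T" "x - normal_part T x \<in> T"
    using yz span_base[of _ T] assms
    by (auto simp: orthogonal_comp_def orthogonal_commute span_eq_iff[THEN iffD2])
qed

section \<open>Metric and Christoffel symbols of an immersion\<close>

text \<open>The data for computing at a single point: continuous second derivatives give symmetric
  second partials, and injectivity of the derivative makes the induced metric positive
  definite.\<close>

locale C2_immersion =
  fixes \<phi> :: "real^'n::finite \<Rightarrow> real^'m" and U :: "(real^'n) set" and u :: "real^'n"
  assumes open_domain: "open U" and in_domain: "u \<in> U" and C2: "Ck_on 2 \<phi> U"
    and immersion: "inj (frechet_derivative \<phi> (at u))"
begin

abbreviation "D \<equiv> frechet_derivative \<phi> (at u)"

lemma first_derivative: "w \<in> U \<Longrightarrow> (\<phi> has_derivative frechet_derivative \<phi> (at w)) (at w)"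
  using C2 by (simp add: numeral_2_eq_2 frechet_derivative_works)

lemma second_derivative:
  "w \<in> U \<Longrightarrow> ((\<lambda>x. frechet_derivative \<phi> (at x) c) has_derivative
     frechet_derivative (\<lambda>x. frechet_derivative \<phi> (at x) c) (at w)) (at w)"
  using C2 by (simp add: numeral_2_eq_2 frechet_derivative_works)

lemma pd_has_derivative_at: "(pd i \<phi> has_derivative frechet_derivative (pd i \<phi>) (at u)) (at u)"
  using second_derivative[OF in_domain] by (simp add: pd_def[abs_def])

lemma linear_D: "linear D"
  using first_derivative[OF in_domain] by (rule has_derivative_linear)

lemma D_expansion: "D a = (\<Sum>i\<in>UNIV. a $ i *\<^sub>R pd i \<phi> u)"
  unfolding pd_def by (rule linear_axis_expansion[OF linear_D])

lemma pd_commute: "pd i (pd j \<phi>) u = pd j (pd i \<phi>) u"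
  unfolding pd_def
  by (rule symmetric_second_derivative[OF open_domain in_domain first_derivative second_derivative])
    (use C2 in \<open>simp_all add: numeral_2_eq_2\<close>)

lemma metric_at_induced: "metric_at (induced_metric \<phi>) u a b = D a \<bullet> D b"
  by (simp add: metric_at_def induced_metric_def D_expansion inner_sum_left inner_sum_right
      sum_distrib_left mult_ac) (rule sum.swap)

lemma frame_induced:
  "orthonormal_basis (metric_at (induced_metric \<phi>) u) (frame (metric_at (induced_metric \<phi>) u))"
proof (rule orthonormal_basis_frame)
  interpret L: linear D by (rule linear_D)
  show "bilinear (metric_at (induced_metric \<phi>) u)"
    by (auto simp: bilinear_def metric_at_induced L.add L.scale inner_add_left inner_add_right
        intro!: linearI)
  show "metric_at (induced_metric \<phi>) u a b = metric_at (induced_metric \<phi>) u b a" for a b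
    by (simp add: metric_at_induced inner_commute)
  show "metric_at (induced_metric \<phi>) u a a > 0" if "a \<noteq> 0" for a
    using that immersion L.zero by (auto simp: metric_at_induced dest: injD[where x = a and y = 0])
qed

text \<open>For the Gram matrix G, the number \<open>a \<bullet> G a\<close> is the squared length
  of \<open>D a\<close>, so the kernel is trivial. Invertibility has to be established first because
  \<open>matrix_inv\<close> is a choice among inverses.\<close>

lemma induced_metric_inverse:
  "induced_metric \<phi> u ** matrix_inv (induced_metric \<phi> u) = mat 1"
proof -
  have "a = 0" if "induced_metric \<phi> u *v a = 0" for a
  proof -
    have "a \<bullet> (induced_metric \<phi> u *v a) = metric_at (induced_metric \<phi>) u a a"
      by (simp add: metric_at_def inner_vec_def matrix_vector_mult_def sum_distrib_left mult_ac)
    then have "D a \<bullet> D a = 0" using that by (simp add: metric_at_induced)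
    then have "D a = D 0" using linear_0[OF linear_D] by simp
    then show ?thesis using immersion by (blast dest: injD)
  qed
  then have "invertible (induced_metric \<phi> u)"
    by (metis invertible_left_inverse matrix_left_invertible_ker)
  then show ?thesis
    unfolding invertible_def matrix_inv_def by (rule someI_ex[THEN conjunct1])
qed

lemma pd_induced_metric:
  "pd i (\<lambda>w. induced_metric \<phi> w $ j $ l) u =
     pd i (pd j \<phi>) u \<bullet> pd l \<phi> u + pd j \<phi> u \<bullet> pd i (pd l \<phi>) u"
proof -
  have "((\<lambda>w. pd j \<phi> w \<bullet> pd l \<phi> w) has_derivative
      (\<lambda>c. pd j \<phi> u \<bullet> frechet_derivative (pd l \<phi>) (at u) c +
            frechet_derivative (pd j \<phi>) (at u) c \<bullet> pd l \<phi> u)) (at u)"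
    by (rule has_derivative_inner[OF pd_has_derivative_at pd_has_derivative_at])
  from pd_has_derivative[OF this, of i] show ?thesis
    by (simp add: induced_metric_def) (simp add: pd_def)
qed

text \<open>The product rule turns the three metric derivatives into six terms. By symmetry of
  second partials four cancel and two coincide, which absorbs the factor 1/2.\<close>

lemma christoffel_induced:
  "christoffel (induced_metric \<phi>) l i j u =
     (\<Sum>m\<in>UNIV. matrix_inv (induced_metric \<phi> u) $ l $ m * (pd i (pd j \<phi>) u \<bullet> pd m \<phi> u))"
proof -
  have "pd i (\<lambda>w. induced_metric \<phi> w $ j $ m) u + pd j (\<lambda>w. induced_metric \<phi> w $ i $ m) u
      - pd m (\<lambda>w. induced_metric \<phi> w $ i $ j) u = 2 * (pd i (pd j \<phi>) u \<bullet> pd m \<phi> u)" for m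
    unfolding pd_induced_metric
    by (simp add: pd_commute[of m] pd_commute[of j i] inner_commute)
  then show ?thesis
    by (simp add: christoffel_def sum_distrib_left mult_ac)
qed

lemma subspace_tangent: "subspace (tangent_space \<phi> u)"
  unfolding tangent_space_def using linear_subspace_image[OF linear_D subspace_UNIV] .

text \<open>Gauss' formula for the coordinate fields.\<close>

lemma normal_part_second_derivative:
  "normal_part (tangent_space \<phi> u) (pd i (pd j \<phi>) u) =
     pd i (pd j \<phi>) u - (\<Sum>l\<in>UNIV. christoffel (induced_metric \<phi>) l i j u *\<^sub>R pd l \<phi> u)"
    (is "_ = ?w")
proof (rule normal_part_eqI[OF subspace_tangent])
  let ?G = "induced_metric \<phi> u"
  have r: "pd r \<phi> u \<bullet> ?w = 0" for r
  proof -
    \<comment> \<open>Contracting with the Gram matrix undoes its inverse, so the Christoffel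
      combination has the same inner product with each coordinate field as the second
      derivative.\<close>
    have "(\<Sum>l\<in>UNIV. christoffel (induced_metric \<phi>) l i j u * (pd r \<phi> u \<bullet> pd l \<phi> u)) =
        (\<Sum>l\<in>UNIV. \<Sum>m\<in>UNIV. ?G $ r $ l * matrix_inv ?G $ l $ m * (pd i (pd j \<phi>) u \<bullet> pd m \<phi> u))"
      by (simp add: christoffel_induced induced_metric_def sum_distrib_left sum_distrib_right mult_ac)
    also have "\<dots> = (\<Sum>m\<in>UNIV. (?G ** matrix_inv ?G) $ r $ m * (pd i (pd j \<phi>) u \<bullet> pd m \<phi> u))"
      by (subst sum.swap) (simp add: matrix_matrix_mult_def sum_distrib_right)
    also have "\<dots> = (\<Sum>m\<in>UNIV. if r = m then pd i (pd j \<phi>) u \<bullet> pd m \<phi> u else 0)"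
      unfolding induced_metric_inverse by (rule sum.cong) (auto simp: mat_def)
    also have "\<dots> = pd r \<phi> u \<bullet> pd i (pd j \<phi>) u" by (simp add: inner_commute)
    finally show ?thesis by (simp add: inner_diff_right inner_sum_right)
  qed
  then show "?w \<in> orthogonal_comp (tangent_space \<phi> u)"
    by (auto simp: orthogonal_comp_def orthogonal_def tangent_space_def D_expansion inner_sum_left)
  have "(\<Sum>l\<in>UNIV. christoffel (induced_metric \<phi>) l i j u *\<^sub>R pd l \<phi> u) =
      D (\<chi> l. christoffel (induced_metric \<phi>) l i j u)"
    by (simp add: D_expansion)
  then show "pd i (pd j \<phi>) u - ?w \<in> tangent_space \<phi> u"
    by (simp add: tangent_space_def)
qed

section \<open>Hessians of coordinate functions and the Lovelock operator\<close>

text \<open>Pairing with \<open>v\<close> is linear and commutes with both derivatives, so the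
  Christoffel correction in the Hessian is exactly the one in Gauss' formula.\<close>

lemma hess_coordinate_function:
  "hess (induced_metric \<phi>) (coordinate_function v \<circ> \<phi>) u a b =
     second_fundamental_form \<phi> u a b \<bullet> v"
proof -
  have first: "pd j (coordinate_function v \<circ> \<phi>) w = v \<bullet> pd j \<phi> w" if "w \<in> U" for j w
  proof -
    have "((\<lambda>x. v \<bullet> \<phi> x) has_derivative (\<lambda>c. v \<bullet> frechet_derivative \<phi> (at w) c)) (at w)"
      by (rule has_derivative_inner_right[OF first_derivative[OF that]])
    from pd_has_derivative[OF this, of j] show ?thesis
      by (simp add: coordinate_function_def o_def) (simp add: pd_def)
  qed
  have second: "pd i (pd j (coordinate_function v \<circ> \<phi>)) u = v \<bullet> pd i (pd j \<phi>) u" for i j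
  proof -
    have "((\<lambda>x. v \<bullet> pd j \<phi> x) has_derivative (\<lambda>c. v \<bullet> frechet_derivative (pd j \<phi>) (at u) c)) (at u)"
      by (rule has_derivative_inner_right[OF pd_has_derivative_at])
    \<comment> \<open>A second differentiation needs the formula for the first partials on a
      neighbourhood of u; this is why \<open>first\<close> is stated on all of
      \<open>U\<close>.\<close>
    then have "(pd j (coordinate_function v \<circ> \<phi>) has_derivative
        (\<lambda>c. v \<bullet> frechet_derivative (pd j \<phi>) (at u) c)) (at u)"
      by (rule has_derivative_transform_within_open[OF _ open_domain in_domain]) (simp add: first)
    from pd_has_derivative[OF this, of i] show ?thesis by (simp add: pd_def)
  qed
  show ?thesis
    unfolding hess_def second_fundamental_form_def normal_part_second_derivative second
      first[OF in_domain]
    by (simp add: inner_sum_right inner_diff_right inner_commute)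
qed

lemma second_fundamental_form_normal:
  "second_fundamental_form \<phi> u a b \<in> orthogonal_comp (tangent_space \<phi> u)"
  unfolding second_fundamental_form_def
  by (intro subspace_sum subspace_scale subspace_orthogonal_comp normal_part_exists(1)
      subspace_tangent)

text \<open>\<open>v\<close> differs from its normal part by a tangent vector, which is orthogonal
  to the normal-valued B.\<close>

lemma second_fundamental_form_inner_normal_part:
  "second_fundamental_form \<phi> u a b \<bullet> normal_part (tangent_space \<phi> u) v =
     second_fundamental_form \<phi> u a b \<bullet> v"
proof -
  have "second_fundamental_form \<phi> u a b \<bullet> (v - normal_part (tangent_space \<phi> u) v) = 0"
    using second_fundamental_form_normal[of a b] normal_part_exists(2)[OF subspace_tangent, of v]
    by (auto simp only: orthogonal_comp_def orthogonal_def inner_commute mem_Collect_eq)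
  then show ?thesis by (simp add: inner_diff_right)
qed

text \<open>\<open>df_hodge_prod_bilinear\<close> with the normalised product of powers of the
  metric and of the curvature as its double form. The curvature stays unexpanded, being the same
  factor on both sides; \<open>v\<close> may be any ambient vector.\<close>

lemma lovelock_operator_coordinate_function:
  "lovelock_operator (induced_metric \<phi>) k (coordinate_function v \<circ> \<phi>) u = - h_odd \<phi> k u v"
  by (simp add: lovelock_operator_def h_odd_def einstein_lovelock_def Let_def df_prod_scale_left
      df_hodge_prod_bilinear[OF frame_induced, symmetric] hess_coordinate_function[abs_def])

lemma h_odd_normal_part: "h_odd \<phi> k u (normal_part (tangent_space \<phi> u) v) = h_odd \<phi> k u v"
  by (simp add: h_odd_def second_fundamental_form_inner_normal_part)

lemma normal_part_in_normal_space: "normal_part (tangent_space \<phi> u) v \<in> normal_space \<phi> u"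
  unfolding normal_space_def by (rule normal_part_exists(1)[OF subspace_tangent])

end

lemma C2_immersion_local_param:
  assumes "local_param M U \<phi>" "u \<in> U"
  shows "C2_immersion \<phi> U u"
  using assms by unfold_locales (auto simp: local_param_def smooth_on_def)

theorem proposition3p12:
  fixes M :: "(real^'m) set" and k p :: nat
  assumes "submanifold TYPE('n::finite) M"
    and "CARD('m) = CARD('n) + p"
    and "2 * k < CARD('n)"
  shows "minimal_2k TYPE('n) k M \<longleftrightarrow>
         (\<forall>v. ell_harmonic TYPE('n) k M (coordinate_function v))"
proof (intro iffI allI)
  fix v assume min: "minimal_2k TYPE('n) k M"
  show "ell_harmonic TYPE('n) k M (coordinate_function v)"
    unfolding ell_harmonic_def
  proof (intro allI impI ballI)
    fix U and \<phi> :: "real^'n \<Rightarrow> real^'m" and u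
    assume "local_param M U \<phi>" "u \<in> U"
    then interpret C2_immersion \<phi> U u by (rule C2_immersion_local_param)
    \<comment> \<open>Minimality speaks of normal vectors only, so it is applied to the normal part
      of \<open>v\<close>, which leaves \<open>h_odd\<close> unchanged.\<close>
    have "h_odd \<phi> k u (normal_part (tangent_space \<phi> u) v) = 0"
      using min \<open>local_param M U \<phi>\<close> \<open>u \<in> U\<close> normal_part_in_normal_space
      by (auto simp: minimal_2k_def)
    then show "lovelock_operator (induced_metric \<phi>) k (coordinate_function v \<circ> \<phi>) u = 0"
      by (simp add: lovelock_operator_coordinate_function h_odd_normal_part)
  qed
next
  assume harm: "\<forall>v. ell_harmonic TYPE('n) k M (coordinate_function v)"
  show "minimal_2k TYPE('n) k M"
    unfolding minimal_2k_def
  proof (intro allI impI ballI)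
    fix U and \<phi> :: "real^'n \<Rightarrow> real^'m" and u N
    assume "local_param M U \<phi>" "u \<in> U"
    then interpret C2_immersion \<phi> U u by (rule C2_immersion_local_param)
    \<comment> \<open>The given normal vector itself serves as the direction of the coordinate
      function.\<close>
    have "lovelock_operator (induced_metric \<phi>) k (coordinate_function N \<circ> \<phi>) u = 0"
      using harm \<open>local_param M U \<phi>\<close> \<open>u \<in> U\<close> by (auto simp: ell_harmonic_def)
    then show "h_odd \<phi> k u N = 0"
      by (simp add: lovelock_operator_coordinate_function)
  qed
qed

end
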